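(* Consider an instance of the maintenance scheduling problem (with or without storage nodes) with optimal value $\varphi^*=\max\{\operatorname{val}(t^* ) : t^*\in X\}$. Let $0=t_0<t_1<\cdots<t_n=T$ be a conformal time discretization, and let $\underline{\varphi}$ be the optimal value of the associated lower bound integer program defined in the context. Then $\varphi^*\geqslant\underline{\varphi}$.
   Context: The maintenance scheduling problem. $N=(V,A,s,t)$ is a finite directed network (parallel arcs allowed) with distinct source $s$ and sink $t$; $\delta^{\text{out}}(v)$ and $\delta^{\text{in}}(v)$ are the sets of arcs starting, respectively ending, at $v$. $W\subseteq V\setminus\{s,t\}$ is a set of storage nodes, and $u=(u_x)_{x\in A\cup W}$ are nonnegative capacities (flow per unit time for arcs, stored amount for nodes in $W$). $T>0$ is the time horizon. $A_1\subseteq A$ is the set of arcs with a maintenance job; each $a\in A_1$ has exactly one job, with processing time $p_a>0$, release time $r_a$ and deadline $d_a$, where $0\leqslant r_a\leqslant d_a-p_a$ and $d_a\leqslant T$. A feasible solution is a start time vector $t^*=(t^*_a)_{a\in A_1}\in X:=\prod_{a\in A_1}[r_a,d_a-p_a]$. Value of a solution. Given $t^*\in X$, let $0=\tau_0<\tau_1<\cdots<\tau_m=T$ be the increasing enumeration of the set $\{t^*_a : a\in A_1\}\cup\{t^*_a+p_a : a\in A_1\}\cup\{0,T\}$, and for $a\in A_1$ let $I_a=\{i\in\{1,\dots,m\} : t^*_a<\tau_i\leqslant t^*_a+p_a\}$. Then $\operatorname{val}(t^* )$ is the maximum of $\sum_{i=1}^m\big(\sum_{a\in\delta^{\text{out}}(s)}x_{ai}-\sum_{a\in\delta^{\text{in}}(s)}x_{ai}\big)$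 over all nonnegative reals $x_{ai}$ ($a\in A$, $1\leqslant i\leqslant m$) and $x_{vi}$ ($v\in W$, $0\leqslant i\leqslant m$) satisfying: $\sum_{a\in\delta^{\text{out}}(v)}x_{ai}=\sum_{a\in\delta^{\text{in}}(v)}x_{ai}$ for $v\in V\setminus(W\cup\{s,t\})$, $1\leqslant i\leqslant m$; $\sum_{a\in\delta^{\text{out}}(v)}x_{ai}+x_{vi}=\sum_{a\in\delta^{\text{in}}(v)}x_{ai}+x_{v,i-1}$ for $v\in W$, $1\leqslant i\leqslant m$; $x_{ai}\leqslant(\tau_i-\tau_{i-1})u_a$ for $a\in A\setminus A_1$ and all $i$, and for $a\in A_1$ and $i\notin I_a$; $x_{ai}=0$ for $a\in A_1$, $i\in I_a$; $x_{vi}\leqslant u_v$ for $v\in W$, $0\leqslant i\leqslant m$; $x_{v0}=x_{vm}=0$ for $v\in W$. Conformal discretization. A discretization $0=t_0<t_1<\cdots<t_n=T$ with $\Gamma=\{t_0,\dots,t_n\}$ is conformal if (i) $\bigcup_{a\in A_1}\{r_a,d_a\}\subseteq\Gamma$, and (ii) for any $i\in\{0,\dots,n\}$ and any $a\in A_1$: if $t_i\in[r_a,d_a-p_a]$ then $t_i+p_a\in\Gamma$, and if $t_i\in[r_a+p_a,d_a]$ then $t_i-p_a\in\Gamma$. Lower bound integer program. For $a\in A_1$ let $\mathcal S_a=\{i\in\{1,\dots,n\} : r_a<t_i,\ d_a-p_a\geqslant t_{i-1}\}$ and $\mathcal T_a=\{i\in\{1,\dots,n\} : d_a>t_{i-1},\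 r_a<t_i\}$; for $i\in\mathcal S_a$ let $Q_{ai}=\{k\in\mathcal T_a : k\geqslant i,\ t_i+p_a>t_{k-1}\}$; for $i\in\mathcal T_a$ let $P_{ai}=\{k\in\mathcal S_a : t_{k-1}\leqslant t_{i-1},\ t_{k-1}+p_a\geqslant t_i\}$ (the set of $k$ such that a job on $a$ started at $t_{k-1}$ is processed during the whole of interval $i$). The variables are $x_{ai}\geqslant0$ ($a\in A$, $1\leqslant i\leqslant n$), $x_{vi}\geqslant 0$ ($v\in W$, $0\leqslant i\leqslant n$), $y_{ai}\in\{0,1\}$ ($a\in A_1$, $i\in\mathcal S_a$), $z_{ai}\in\{0,1\}$ ($a\in A_1$, $i\in\mathcal T_a$). The program maximizes $\sum_{i=1}^n\big(\sum_{a\in\delta^{\text{out}}(s)}x_{ai}-\sum_{a\in\delta^{\text{in}}(s)}x_{ai}\big)$ subject to: 1. $\sum_{a\in\delta^{\text{out}}(v)}x_{ai}=\sum_{a\in\delta^{\text{in}}(v)}x_{ai}$ for $v\in V\setminus(W\cup\{s,t\})$, $1\leqslant i\leqslant n$; 2. $\sum_{a\in\delta^{\text{out}}(v)}x_{ai}+x_{vi}=\sum_{a\in\delta^{\text{in}}(v)}x_{ai}+x_{v,i-1}$ for $v\in W$, $1\leqslant i\leqslant n$; 3. $x_{ai}\leqslant(t_i-t_{i-1})u_a$ for $a\in A\setminus A_1$, $1\leqslant i\leqslant n$; 4. $x_{vi}\leqslant u_v$ for $v\in W$, $0\leqslant i\leqslant n$, and $x_{v0}=x_{vn}=0$ for $v\in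 W$; 5. $\sum_{i\in\mathcal S_a}y_{ai}=1$ for $a\in A_1$; 6. $(t_i-t_{i-1})z_{ai}\leqslant\min\{t_i,d_a\}-\max\{t_{i-1},r_a\}$ for $a\in A_1$, $i\in\mathcal T_a$; 7. $\sum_{i\in\mathcal T_a}(t_i-t_{i-1})z_{ai}=p_a$ for $a\in A_1$; 8. $\sum_{k\in Q_{ai}}(t_k-t_{k-1})z_{ak}\geqslant p_a y_{ai}$ for $a\in A_1$, $i\in\mathcal S_a$; 9. $z_{ai}=\sum_{k\in P_{ai}}y_{ak}$ for $a\in A_1$, $i\in\mathcal T_a$; 10. $x_{ai}\leqslant(t_i-t_{i-1})(1-z_{ai})u_a$ for $a\in A_1$, $i\in\mathcal T_a$; 11. $x_{ai}\leqslant(t_i-t_{i-1})u_a$ for $a\in A_1$, $i\in\{1,\dots,n\}\setminus\mathcal T_a$. *)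

theory Defs
  imports Complex_Main "HOL-Library.FuncSet" "Graph_Theory.Digraph"
begin

section \<open>Instances\<close>

record ('v, 'a) maintenance_instance =
  net :: "('v, 'a) pre_digraph"
  source :: 'v
  sink :: 'v
  storage :: "'v set"
  arc_cap :: "'a \<Rightarrow> real"
  node_cap :: "'v \<Rightarrow> real"
  horizon :: real
  jobs :: "'a set"  \<comment> \<open>the arcs carrying a maintenance job (exactly one each)\<close>
  ptime :: "'a \<Rightarrow> real"
  release :: "'a \<Rightarrow> real"
  deadline :: "'a \<Rightarrow> real"

locale maintenance_problem =
  fixes I :: "('v, 'a) maintenance_instance"
  assumes fin_net: "fin_digraph (net I)"
    and source_in: "source I \<in> verts (net I)"
    and sink_in: "sink I \<in> verts (net I)"
    and source_neq_sink: "source I \<noteq> sink I"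
    and storage_sub: "storage I \<subseteq> verts (net I) - {source I, sink I}"
    and arc_cap_nonneg: "\<And>a. a \<in> arcs (net I) \<Longrightarrow> 0 \<le> arc_cap I a"
    and node_cap_nonneg: "\<And>v. v \<in> storage I \<Longrightarrow> 0 \<le> node_cap I v"
    and horizon_pos: "0 < horizon I"
    and jobs_sub: "jobs I \<subseteq> arcs (net I)"
    and ptime_pos: "\<And>a. a \<in> jobs I \<Longrightarrow> 0 < ptime I a"
    and release_nonneg: "\<And>a. a \<in> jobs I \<Longrightarrow> 0 \<le> release I a"
    and window: "\<And>a. a \<in> jobs I \<Longrightarrow> release I a \<le> deadline I a - ptime I a"
    and deadline_le: "\<And>a. a \<in> jobs I \<Longrightarrow> deadline I a \<le> horizon I"

definition schedules :: "('v, 'a) maintenance_instance \<Rightarrow> ('a \<Rightarrow> real) set" where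
  "schedules I = (\<Pi>\<^sub>E a\<in>jobs I. {release I a .. deadline I a - ptime I a})"

section \<open>Flows over a sequence of time intervals\<close>

text \<open>
  Throughout, \<open>x a i\<close> is the total flow on arc \<open>a\<close> during the interval number \<open>i\<close> (counted from 1),
  and \<open>w v i\<close> is the amount stored in node \<open>v\<close> at the end of interval \<open>i\<close>
  (for \<open>i = 0\<close>: at the beginning).
  The following constraints are common to the linear program defining the value of a schedule and
  to the integer program.
\<close>

definition flow_balance ::
  "('v, 'a) maintenance_instance \<Rightarrow> nat \<Rightarrow> ('a \<Rightarrow> nat \<Rightarrow> real) \<Rightarrow> ('v \<Rightarrow> nat \<Rightarrow> real) \<Rightarrow> bool" where
  "flow_balance I m x w \<longleftrightarrow>
     (\<forall>a\<in>arcs (net I). \<forall>i\<in>{1..m}. 0 \<le> x a i) \<and>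
     (\<forall>v\<in>storage I. \<forall>i\<in>{0..m}. 0 \<le> w v i) \<and>
     (\<forall>v\<in>verts (net I) - (storage I \<union> {source I, sink I}). \<forall>i\<in>{1..m}.
        (\<Sum>a\<in>out_arcs (net I) v. x a i) = (\<Sum>a\<in>in_arcs (net I) v. x a i)) \<and>
     (\<forall>v\<in>storage I. \<forall>i\<in>{1..m}.
        (\<Sum>a\<in>out_arcs (net I) v. x a i) + w v i
          = (\<Sum>a\<in>in_arcs (net I) v. x a i) + w v (i - 1)) \<and>
     (\<forall>v\<in>storage I. \<forall>i\<in>{0..m}. w v i \<le> node_cap I v) \<and>
     (\<forall>v\<in>storage I. w v 0 = 0 \<and> w v m = 0)"

definition flow_value ::
  "('v, 'a) maintenance_instance \<Rightarrow> nat \<Rightarrow> ('a \<Rightarrow> nat \<Rightarrow> real) \<Rightarrow> real" where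
  "flow_value I m x =
     (\<Sum>i=1..m. (\<Sum>a\<in>out_arcs (net I) (source I). x a i)
              - (\<Sum>a\<in>in_arcs (net I) (source I). x a i))"

section \<open>The value of a schedule and the optimal value\<close>

definition breakpoints :: "('v, 'a) maintenance_instance \<Rightarrow> ('a \<Rightarrow> real) \<Rightarrow> real set" where
  "breakpoints I \<sigma> =
     {\<sigma> a |a. a \<in> jobs I} \<union> {\<sigma> a + ptime I a |a. a \<in> jobs I} \<union> {0, horizon I}"

text \<open>Increasing enumeration: \<open>\<tau> I \<sigma> 0 = 0\<close> and \<open>\<tau> I \<sigma> (intervals I \<sigma>) = horizon I\<close>.\<close>

definition \<tau> :: "('v, 'a) maintenance_instance \<Rightarrow> ('a \<Rightarrow> real) \<Rightarrow> nat \<Rightarrow> real" where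
  "\<tau> I \<sigma> i = sorted_list_of_set (breakpoints I \<sigma>) ! i"

definition intervals :: "('v, 'a) maintenance_instance \<Rightarrow> ('a \<Rightarrow> real) \<Rightarrow> nat" where
  "intervals I \<sigma> = card (breakpoints I \<sigma>) - 1"

definition busy :: "('v, 'a) maintenance_instance \<Rightarrow> ('a \<Rightarrow> real) \<Rightarrow> 'a \<Rightarrow> nat set" where
  "busy I \<sigma> a = {i \<in> {1..intervals I \<sigma>}. \<sigma> a < \<tau> I \<sigma> i \<and> \<tau> I \<sigma> i \<le> \<sigma> a + ptime I a}"

definition feasible_flow ::
  "('v, 'a) maintenance_instance \<Rightarrow> ('a \<Rightarrow> real) \<Rightarrow> ('a \<Rightarrow> nat \<Rightarrow> real) \<Rightarrow> ('v \<Rightarrow> nat \<Rightarrow> real) \<Rightarrow> bool"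
  where
  "feasible_flow I \<sigma> x w \<longleftrightarrow>
     flow_balance I (intervals I \<sigma>) x w \<and>
     (\<forall>a\<in>arcs (net I) - jobs I. \<forall>i\<in>{1..intervals I \<sigma>}.
        x a i \<le> (\<tau> I \<sigma> i - \<tau> I \<sigma> (i - 1)) * arc_cap I a) \<and>
     (\<forall>a\<in>jobs I. \<forall>i\<in>{1..intervals I \<sigma>} - busy I \<sigma> a.
        x a i \<le> (\<tau> I \<sigma> i - \<tau> I \<sigma> (i - 1)) * arc_cap I a) \<and>
     (\<forall>a\<in>jobs I. \<forall>i\<in>busy I \<sigma> a. x a i = 0)"

text \<open>
  Maxima are written as suprema of sets of reals. The lemmas \<open>val_well_defined\<close>,
  \<open>optimal_value_well_defined\<close> and \<open>lower_bound_value_well_defined\<close> show that these sets are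
  nonempty and bounded above, so no supremum takes an unspecified value.
\<close>

definition val :: "('v, 'a) maintenance_instance \<Rightarrow> ('a \<Rightarrow> real) \<Rightarrow> real" where
  "val I \<sigma> = Sup {flow_value I (intervals I \<sigma>) x |x w. feasible_flow I \<sigma> x w}"

definition optimal_value :: "('v, 'a) maintenance_instance \<Rightarrow> real" where
  "optimal_value I = (SUP \<sigma>\<in>schedules I. val I \<sigma>)"

section \<open>Conformal discretizations\<close>

definition discretization ::
  "('v, 'a) maintenance_instance \<Rightarrow> nat \<Rightarrow> (nat \<Rightarrow> real) \<Rightarrow> bool" where
  "discretization I n t \<longleftrightarrow> t 0 = 0 \<and> t n = horizon I \<and> (\<forall>i<n. t i < t (Suc i))"

definition conformal ::
  "('v, 'a) maintenance_instance \<Rightarrow> nat \<Rightarrow> (nat \<Rightarrow> real) \<Rightarrow> bool" where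
  "conformal I n t \<longleftrightarrow>
     (\<Union>a\<in>jobs I. {release I a, deadline I a}) \<subseteq> t ` {0..n} \<and>
     (\<forall>i\<in>{0..n}. \<forall>a\<in>jobs I.
        (t i \<in> {release I a .. deadline I a - ptime I a} \<longrightarrow> t i + ptime I a \<in> t ` {0..n}) \<and>
        (t i \<in> {release I a + ptime I a .. deadline I a} \<longrightarrow> t i - ptime I a \<in> t ` {0..n}))"

section \<open>The lower bound integer program\<close>

definition start_set ::
  "('v, 'a) maintenance_instance \<Rightarrow> nat \<Rightarrow> (nat \<Rightarrow> real) \<Rightarrow> 'a \<Rightarrow> nat set" where
  "start_set I n t a =
     {i \<in> {1..n}. release I a < t i \<and> deadline I a - ptime I a \<ge> t (i - 1)}"

definition active_set ::
  "('v, 'a) maintenance_instance \<Rightarrow> nat \<Rightarrow> (nat \<Rightarrow> real) \<Rightarrow> 'a \<Rightarrow> nat set" where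
  "active_set I n t a = {i \<in> {1..n}. deadline I a > t (i - 1) \<and> release I a < t i}"

definition Q_set ::
  "('v, 'a) maintenance_instance \<Rightarrow> nat \<Rightarrow> (nat \<Rightarrow> real) \<Rightarrow> 'a \<Rightarrow> nat \<Rightarrow> nat set" where
  "Q_set I n t a i = {k \<in> active_set I n t a. k \<ge> i \<and> t i + ptime I a > t (k - 1)}"

definition P_set ::
  "('v, 'a) maintenance_instance \<Rightarrow> nat \<Rightarrow> (nat \<Rightarrow> real) \<Rightarrow> 'a \<Rightarrow> nat \<Rightarrow> nat set" where
  "P_set I n t a i =
     {k \<in> start_set I n t a. t (k - 1) \<le> t (i - 1) \<and> t (k - 1) + ptime I a \<ge> t i}"

definition lb_feasible ::
  "('v, 'a) maintenance_instance \<Rightarrow> nat \<Rightarrow> (nat \<Rightarrow> real) \<Rightarrow>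
   ('a \<Rightarrow> nat \<Rightarrow> real) \<Rightarrow> ('v \<Rightarrow> nat \<Rightarrow> real) \<Rightarrow>
   ('a \<Rightarrow> nat \<Rightarrow> real) \<Rightarrow> ('a \<Rightarrow> nat \<Rightarrow> real) \<Rightarrow> bool" where
  "lb_feasible I n t x w y z \<longleftrightarrow>
     flow_balance I n x w \<and>
     (\<forall>a\<in>jobs I. \<forall>i\<in>start_set I n t a. y a i \<in> {0, 1}) \<and>
     (\<forall>a\<in>jobs I. \<forall>i\<in>active_set I n t a. z a i \<in> {0, 1}) \<and>
     (\<forall>a\<in>arcs (net I) - jobs I. \<forall>i\<in>{1..n}. x a i \<le> (t i - t (i - 1)) * arc_cap I a) \<and>
     (\<forall>a\<in>jobs I. (\<Sum>i\<in>start_set I n t a. y a i) = 1) \<and>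
     (\<forall>a\<in>jobs I. \<forall>i\<in>active_set I n t a.
        (t i - t (i - 1)) * z a i \<le> min (t i) (deadline I a) - max (t (i - 1)) (release I a)) \<and>
     (\<forall>a\<in>jobs I. (\<Sum>i\<in>active_set I n t a. (t i - t (i - 1)) * z a i) = ptime I a) \<and>
     (\<forall>a\<in>jobs I. \<forall>i\<in>start_set I n t a.
        (\<Sum>k\<in>Q_set I n t a i. (t k - t (k - 1)) * z a k) \<ge> ptime I a * y a i) \<and>
     (\<forall>a\<in>jobs I. \<forall>i\<in>active_set I n t a. z a i = (\<Sum>k\<in>P_set I n t a i. y a k)) \<and>
     (\<forall>a\<in>jobs I. \<forall>i\<in>active_set I n t a.
        x a i \<le> (t i - t (i - 1)) * (1 - z a i) * arc_cap I a) \<and>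
     (\<forall>a\<in>jobs I. \<forall>i\<in>{1..n} - active_set I n t a. x a i \<le> (t i - t (i - 1)) * arc_cap I a)"

definition lower_bound_value ::
  "('v, 'a) maintenance_instance \<Rightarrow> nat \<Rightarrow> (nat \<Rightarrow> real) \<Rightarrow> real" where
  "lower_bound_value I n t = Sup {flow_value I n x |x w y z. lb_feasible I n t x w y z}"

section \<open>The suprema are over nonempty sets bounded above\<close>

lemma discretization_less:
  assumes "discretization I n t" "i < j" "j \<le> n"
  shows "t i < t j"
  using assms(2,3)
proof (induction j)
  case (Suc j)
  have "t j < t (Suc j)" using assms(1) Suc.prems by (auto simp: discretization_def)
  then show ?case using Suc by (cases "i = j") auto
qed simp

lemma discretization_less_iff:
  assumes "discretization I n t" "i \<le> n" "j \<le> n"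
  shows "t i < t j \<longleftrightarrow> i < j" "t i \<le> t j \<longleftrightarrow> i \<le> j" "t i = t j \<longleftrightarrow> i = j"
proof -
  have "i < j \<and> t i < t j \<or> i = j \<or> j < i \<and> t j < t i"
    using discretization_less[OF assms(1)] assms(2,3) by (meson linorder_cases)
  then show "t i < t j \<longleftrightarrow> i < j" "t i \<le> t j \<longleftrightarrow> i \<le> j" "t i = t j \<longleftrightarrow> i = j" by auto
qed

lemma flow_value_le:
  assumes "finite (arcs (net I))" and "flow_balance I m x w"
    and cap: "\<And>a i. a \<in> arcs (net I) \<Longrightarrow> i \<in> {1..m} \<Longrightarrow> x a i \<le> (g i - g (i - 1)) * arc_cap I a"
  shows "flow_value I m x \<le> (g m - g 0) * (\<Sum>a\<in>out_arcs (net I) (source I). arc_cap I a)"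
proof -
  let ?O = "out_arcs (net I) (source I)" and ?N = "in_arcs (net I) (source I)"
  have tele: "(\<Sum>i=1..m. g i - g (i - 1)) = g m - g 0"
    by (induction m) (auto simp: sum.atLeast_Suc_atMost)
  have "flow_value I m x \<le> (\<Sum>i=1..m. (g i - g (i - 1)) * (\<Sum>a\<in>?O. arc_cap I a))"
    unfolding flow_value_def
  proof (rule sum_mono)
    fix i assume i: "i \<in> {1..m}"
    have "(\<Sum>a\<in>?O. x a i) \<le> (\<Sum>a\<in>?O. (g i - g (i - 1)) * arc_cap I a)"
      by (rule sum_mono) (use cap i in auto)
    moreover have "0 \<le> (\<Sum>a\<in>?N. x a i)"
      by (rule sum_nonneg) (use assms(2) i in \<open>auto simp: flow_balance_def\<close>)
    ultimately show "(\<Sum>a\<in>?O. x a i) - (\<Sum>a\<in>?N. x a i)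
        \<le> (g i - g (i - 1)) * (\<Sum>a\<in>?O. arc_cap I a)"
      by (simp add: sum_distrib_left)
  qed
  also have "\<dots> = (g m - g 0) * (\<Sum>a\<in>?O. arc_cap I a)"
    by (simp only: tele flip: sum_distrib_right)
  finally show ?thesis .
qed

context maintenance_problem
begin

lemma finite_breakpoints: "finite (breakpoints I \<sigma>)"
proof -
  have "finite (jobs I)"
    using fin_net jobs_sub finite_subset fin_digraph.finite_arcs by blast
  then show ?thesis
    by (simp add: breakpoints_def)
qed

lemma \<tau>_mono: "i \<le> j \<Longrightarrow> j \<le> intervals I \<sigma> \<Longrightarrow> \<tau> I \<sigma> i \<le> \<tau> I \<sigma> j"
proof -
  assume "i \<le> j" "j \<le> intervals I \<sigma>"
  moreover have "card (breakpoints I \<sigma>) > 0"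
    using finite_breakpoints by (auto simp: card_gt_0_iff breakpoints_def)
  ultimately show ?thesis
    unfolding \<tau>_def intervals_def by (intro sorted_nth_mono) auto
qed

lemma breakpoints_bounds:
  assumes "\<sigma> \<in> schedules I" and "b \<in> breakpoints I \<sigma>"
  shows "0 \<le> b" "b \<le> horizon I"
proof -
  have job: "0 \<le> \<sigma> a \<and> 0 < ptime I a \<and> \<sigma> a + ptime I a \<le> horizon I" if "a \<in> jobs I" for a
  proof -
    have "\<sigma> a \<in> {release I a .. deadline I a - ptime I a}"
      using assms(1) that by (auto simp: schedules_def)
    then show ?thesis
      using that release_nonneg[OF that] ptime_pos[OF that] deadline_le[OF that] by auto
  qed
  from assms(2) consider a where "a \<in> jobs I" "b = \<sigma> a" | a where "a \<in> jobs I" "b = \<sigma> a + ptime I a"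
    | "b = 0" | "b = horizon I"
    by (auto simp: breakpoints_def)
  then have "0 \<le> b \<and> b \<le> horizon I"
    by cases (use job horizon_pos in force)+
  then show "0 \<le> b" "b \<le> horizon I" by auto
qed

lemma \<tau>_ends:
  assumes "\<sigma> \<in> schedules I"
  shows "\<tau> I \<sigma> 0 = 0" "\<tau> I \<sigma> (intervals I \<sigma>) = horizon I"
proof -
  let ?B = "breakpoints I \<sigma>" and ?L = "sorted_list_of_set (breakpoints I \<sigma>)"
  have ne: "?B \<noteq> {}" by (auto simp: breakpoints_def)
  have len: "length ?L > 0" "intervals I \<sigma> < length ?L"
    using ne finite_breakpoints[of \<sigma>] by (auto simp: intervals_def card_gt_0_iff)
  have in_B: "\<tau> I \<sigma> i \<in> ?B" if "i \<le> intervals I \<sigma>" for i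
    using that len nth_mem[of i ?L] finite_breakpoints[of \<sigma>] by (simp add: \<tau>_def)
  have ex: "\<exists>i\<le>intervals I \<sigma>. \<tau> I \<sigma> i = b" if "b \<in> ?B" for b
  proof -
    from that have "b \<in> set ?L" using finite_breakpoints by simp
    then obtain i where "i < length ?L" "?L ! i = b" by (auto simp: in_set_conv_nth)
    then show ?thesis by (intro exI[of _ i]) (auto simp: \<tau>_def intervals_def)
  qed
  have "0 \<in> ?B" "horizon I \<in> ?B" by (auto simp: breakpoints_def)
  then obtain i j where i: "i \<le> intervals I \<sigma>" "\<tau> I \<sigma> i = 0"
    and j: "j \<le> intervals I \<sigma>" "\<tau> I \<sigma> j = horizon I" using ex by meson
  show "\<tau> I \<sigma> 0 = 0"
    using \<tau>_mono[of 0 i \<sigma>] i breakpoints_bounds(1)[OF assms in_B[of 0]] by auto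
  show "\<tau> I \<sigma> (intervals I \<sigma>) = horizon I"
    using \<tau>_mono[of j "intervals I \<sigma>" \<sigma>] j
      breakpoints_bounds(2)[OF assms in_B[of "intervals I \<sigma>"]] by auto
qed

lemma feasible_flow_zero: "feasible_flow I \<sigma> (\<lambda>_ _. 0) (\<lambda>_ _. 0)"
proof -
  have "\<tau> I \<sigma> (i - 1) \<le> \<tau> I \<sigma> i" if "i \<in> {1..intervals I \<sigma>}" for i
    using that by (intro \<tau>_mono) auto
  then show ?thesis
    using arc_cap_nonneg node_cap_nonneg jobs_sub
    by (auto simp: feasible_flow_def flow_balance_def)
qed

lemma feasible_flow_value_le:
  assumes "\<sigma> \<in> schedules I" and "feasible_flow I \<sigma> x w"
  shows "flow_value I (intervals I \<sigma>) x
    \<le> horizon I * (\<Sum>a\<in>out_arcs (net I) (source I). arc_cap I a)"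
proof -
  let ?m = "intervals I \<sigma>"
  have cap: "x a i \<le> (\<tau> I \<sigma> i - \<tau> I \<sigma> (i - 1)) * arc_cap I a"
    if "a \<in> arcs (net I)" "i \<in> {1..?m}" for a i
  proof (cases "a \<in> jobs I \<and> i \<in> busy I \<sigma> a")
    case True
    then have "x a i = 0" using assms(2) by (auto simp: feasible_flow_def)
    moreover have "\<tau> I \<sigma> (i - 1) \<le> \<tau> I \<sigma> i" using that by (intro \<tau>_mono) auto
    ultimately show ?thesis using arc_cap_nonneg[OF that(1)] by simp
  next
    case False
    then show ?thesis
      using assms(2) that unfolding feasible_flow_def by blast
  qed
  have "flow_value I ?m x
      \<le> (\<tau> I \<sigma> ?m - \<tau> I \<sigma> 0) * (\<Sum>a\<in>out_arcs (net I) (source I). arc_cap I a)"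
    using fin_digraph.finite_arcs[OF fin_net] assms(2) cap
    by (intro flow_value_le) (auto simp: feasible_flow_def)
  then show ?thesis using \<tau>_ends[OF assms(1)] by simp
qed

lemma val_well_defined:
  assumes "\<sigma> \<in> schedules I"
  shows "{flow_value I (intervals I \<sigma>) x |x w. feasible_flow I \<sigma> x w} \<noteq> {}"
    and "bdd_above {flow_value I (intervals I \<sigma>) x |x w. feasible_flow I \<sigma> x w}"
  using feasible_flow_zero feasible_flow_value_le[OF assms] by (auto simp: bdd_above_def)

lemma optimal_value_well_defined: "val I ` schedules I \<noteq> {}" "bdd_above (val I ` schedules I)"
proof -
  have "(\<lambda>a\<in>jobs I. release I a) \<in> schedules I"
    using window by (auto simp: schedules_def)
  then show "val I ` schedules I \<noteq> {}" by auto
  have "val I \<sigma> \<le> horizon I * (\<Sum>a\<in>out_arcs (net I) (source I). arc_cap I a)"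
    if "\<sigma> \<in> schedules I" for \<sigma>
    unfolding val_def using val_well_defined(1)[OF that] feasible_flow_value_le[OF that]
    by (intro cSup_least) auto
  then show "bdd_above (val I ` schedules I)" by (auto simp: bdd_above_def)
qed

lemma lb_feasible_value_le:
  assumes "discretization I n t" and "lb_feasible I n t x w y z"
  shows "flow_value I n x \<le> horizon I * (\<Sum>a\<in>out_arcs (net I) (source I). arc_cap I a)"
proof -
  have cap: "x a i \<le> (t i - t (i - 1)) * arc_cap I a"
    if a: "a \<in> arcs (net I)" and i: "i \<in> {1..n}" for a i
  proof (cases "a \<in> jobs I \<and> i \<in> active_set I n t a")
    case True
    then have z: "z a i \<in> {0, 1}"
      and le: "x a i \<le> (t i - t (i - 1)) * (1 - z a i) * arc_cap I a"
      using assms(2) unfolding lb_feasible_def by blast+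
    have "t (i - 1) < t i"
      using assms(1) i by (intro discretization_less) auto
    then have "0 \<le> (t i - t (i - 1)) * arc_cap I a" using arc_cap_nonneg[OF a] by simp
    then show ?thesis using z le by auto
  next
    case False
    then show ?thesis using assms(2) a i unfolding lb_feasible_def by blast
  qed
  have "flow_value I n x \<le> (t n - t 0) * (\<Sum>a\<in>out_arcs (net I) (source I). arc_cap I a)"
    using fin_digraph.finite_arcs[OF fin_net] assms(2) cap
    by (intro flow_value_le) (auto simp: lb_feasible_def)
  then show ?thesis using assms(1) by (simp add: discretization_def)
qed

text \<open>The integer program is feasible: start every job at its release time and send no flow.\<close>

lemma lb_feasible_release:
  assumes disc: "discretization I n t" and conf: "conformal I n t"
  defines "y \<equiv> \<lambda>a k. of_bool (t (k - 1) = release I a)"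
    and "z \<equiv> \<lambda>a i. of_bool (release I a \<le> t (i - 1) \<and> t i \<le> release I a + ptime I a)"
  shows "lb_feasible I n t (\<lambda>_ _. 0) (\<lambda>_ _. 0) y z"
proof -
  note less = discretization_less_iff[OF disc]
  have step: "t (i - 1) < t i" if "i \<in> {1..n}" for i
    using that by (subst less) auto
  have job: "(\<Sum>i\<in>start_set I n t a. y a i) = 1 \<and>
      (\<Sum>i\<in>active_set I n t a. (t i - t (i - 1)) * z a i) = ptime I a \<and>
      (\<forall>i\<in>start_set I n t a. ptime I a * y a i \<le> (\<Sum>k\<in>Q_set I n t a i. (t k - t (k - 1)) * z a k)) \<and>
      (\<forall>i\<in>active_set I n t a. z a i = (\<Sum>k\<in>P_set I n t a i. y a k)) \<and>
      (\<forall>i\<in>active_set I n t a.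
        (t i - t (i - 1)) * z a i \<le> min (t i) (deadline I a) - max (t (i - 1)) (release I a))"
    if a: "a \<in> jobs I" for a
  proof -
    note p = ptime_pos[OF a] and win = window[OF a] and dl = deadline_le[OF a]
    obtain j where j: "j \<le> n" "t j = release I a"
    proof -
      have "release I a \<in> t ` {0..n}" using conf a unfolding conformal_def by blast
      then show thesis using that by (metis atLeastAtMost_iff imageE)
    qed
    obtain e where e: "e \<le> n" "t e = release I a + ptime I a"
    proof -
      have "t j \<in> {release I a .. deadline I a - ptime I a}" using j(2) win by simp
      then have "t j + ptime I a \<in> t ` {0..n}"
        using conf a j(1) unfolding conformal_def by (meson atLeastAtMost_iff le0)
      then show thesis using that j(2) by (metis atLeastAtMost_iff imageE)
    qed
    have je: "j < e" using less(1)[OF j(1) e(1)] j e p by simp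
    have y: "y a k = of_bool (k = Suc j)" if "k \<in> {1..n}" for k
    proof -
      have "k - 1 \<le> n" using that by auto
      then have "t (k - 1) = release I a \<longleftrightarrow> k - 1 = j"
        using less(3)[of "k - 1" j] j by simp
      moreover have "k - 1 = j \<longleftrightarrow> k = Suc j" using that by auto
      ultimately show ?thesis unfolding y_def by simp
    qed
    have z: "z a i = of_bool (i \<in> {Suc j..e})" if "i \<in> {1..n}" for i
    proof -
      have "i - 1 \<le> n" using that by auto
      then have "release I a \<le> t (i - 1) \<longleftrightarrow> j \<le> i - 1"
        using less(2)[of j "i - 1"] j by simp
      moreover have "j \<le> i - 1 \<longleftrightarrow> Suc j \<le> i" using that by auto
      moreover have "t i \<le> release I a + ptime I a \<longleftrightarrow> i \<le> e"
        using that less(2)[of i e] e by simp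
      ultimately show ?thesis unfolding z_def by simp
    qed
    have S: "Suc j \<in> start_set I n t a"
    proof -
      have "t j < t (Suc j)" using je e(1) by (intro discretization_less[OF disc]) auto
      then show ?thesis using je e(1) j(2) win by (simp add: start_set_def)
    qed
    have fin: "finite (start_set I n t a)" "finite (active_set I n t a)" "finite (Q_set I n t a i)"
      "finite (P_set I n t a i)" for i
      by (auto simp: start_set_def active_set_def Q_set_def P_set_def)
    have act: "{Suc j..e} \<subseteq> active_set I n t a"
    proof
      fix i assume i: "i \<in> {Suc j..e}"
      then have "t i \<le> t e" using less(2)[of i e] e(1) by simp
      moreover have "t j < t i" using less(1)[of j i] i e(1) by simp
      moreover have "t (i - 1) < t i" using step[of i] i e(1) by simp
      ultimately show "i \<in> active_set I n t a"
        using i e j(2) win by (simp add: active_set_def)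
    qed
    have tele: "(\<Sum>i\<in>{Suc j..e}. t i - t (i - 1)) = ptime I a"
      using sum_telescope''[of j e t] je e j by simp
    have sum_z: "(\<Sum>i\<in>X. (t i - t (i - 1)) * z a i) = ptime I a"
      if "{Suc j..e} \<subseteq> X" "X \<subseteq> {1..n}" for X
    proof -
      have zX: "z a i = of_bool (i \<in> {Suc j..e})" if "i \<in> X" for i
        using z \<open>X \<subseteq> {1..n}\<close> that by blast
      have "(\<Sum>i\<in>X. (t i - t (i - 1)) * z a i) = (\<Sum>i\<in>{Suc j..e}. (t i - t (i - 1)) * z a i)"
      proof (rule sum.mono_neutral_right)
        show "finite X" using that(2) by (rule finite_subset) simp
        show "\<forall>i\<in>X - {Suc j..e}. (t i - t (i - 1)) * z a i = 0" using zX by simp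
      qed (fact that(1))
      also have "\<dots> = (\<Sum>i\<in>{Suc j..e}. t i - t (i - 1))"
      proof (rule sum.cong)
        fix i assume "i \<in> {Suc j..e}"
        then show "(t i - t (i - 1)) * z a i = t i - t (i - 1)" using zX[of i] that(1) by auto
      qed simp
      finally show ?thesis using tele by simp
    qed
    have 1: "(\<Sum>i\<in>start_set I n t a. y a i) = 1"
    proof -
      have "(\<Sum>i\<in>start_set I n t a. y a i) = (\<Sum>i\<in>start_set I n t a. if i = Suc j then 1 else 0)"
        using y by (intro sum.cong) (auto simp: start_set_def)
      then show ?thesis using S fin by simp
    qed
    have 2: "(\<Sum>i\<in>active_set I n t a. (t i - t (i - 1)) * z a i) = ptime I a"
      using act by (intro sum_z) (auto simp: active_set_def)
    have 3: "ptime I a * y a i \<le> (\<Sum>k\<in>Q_set I n t a i. (t k - t (k - 1)) * z a k)"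
      if i: "i \<in> start_set I n t a" for i
    proof (cases "i = Suc j")
      case True
      have "t i + ptime I a > t (k - 1)" if "k \<in> {Suc j..e}" for k
      proof -
        have "k - 1 \<le> e" using that by auto
        then have "t (k - 1) \<le> t e" using less(2)[of "k - 1" e] e(1) by simp
        moreover have "t j < t i" using i j(2) by (simp add: start_set_def)
        ultimately show ?thesis using e(2) j(2) by simp
      qed
      then have "{Suc j..e} \<subseteq> Q_set I n t a i"
        using act True by (auto simp: Q_set_def)
      then have "(\<Sum>k\<in>Q_set I n t a i. (t k - t (k - 1)) * z a k) = ptime I a"
        by (intro sum_z) (auto simp: Q_set_def active_set_def)
      moreover have "y a i = 1" using y[of i] True i by (simp add: start_set_def)
      ultimately show ?thesis by simp
    next
      case False
      then have "y a i = 0" using y[of i] i by (simp add: start_set_def)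
      moreover have "0 \<le> (\<Sum>k\<in>Q_set I n t a i. (t k - t (k - 1)) * z a k)"
      proof (intro sum_nonneg mult_nonneg_nonneg)
        fix k assume "k \<in> Q_set I n t a i"
        then show "0 \<le> t k - t (k - 1)" using step[of k] by (simp add: Q_set_def active_set_def)
      qed (simp add: z_def)
      ultimately show ?thesis by simp
    qed
    have 4: "z a i = (\<Sum>k\<in>P_set I n t a i. y a k)" if "i \<in> active_set I n t a" for i
    proof -
      have "(\<Sum>k\<in>P_set I n t a i. y a k) = (\<Sum>k\<in>P_set I n t a i. if k = Suc j then 1 else 0)"
        using y by (intro sum.cong) (auto simp: P_set_def start_set_def)
      also have "\<dots> = of_bool (Suc j \<in> P_set I n t a i)" using fin by simp
      also have "\<dots> = z a i" using S j by (auto simp: z_def P_set_def)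
      finally show ?thesis by simp
    qed
    have 5: "(t i - t (i - 1)) * z a i \<le> min (t i) (deadline I a) - max (t (i - 1)) (release I a)"
      if "i \<in> active_set I n t a" for i
      using that step[of i] win p by (auto simp: z_def active_set_def min_def max_def)
    show ?thesis using 1 2 3 4 5 by blast
  qed
  have cap: "0 \<le> (t i - t (i - 1)) * arc_cap I a" if "a \<in> arcs (net I)" "i \<in> {1..n}" for a i
    using step[OF that(2)] arc_cap_nonneg[OF that(1)] by simp
  have cap': "0 \<le> (t i - t (i - 1)) * (1 - z a i) * arc_cap I a"
    if "a \<in> jobs I" "i \<in> active_set I n t a" for a i
    using cap[of a i] that jobs_sub by (auto simp: z_def active_set_def)
  have bal: "flow_balance I n (\<lambda>_ _. 0) (\<lambda>_ _. 0)"
    using node_cap_nonneg by (auto simp: flow_balance_def)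
  have bin: "y a i \<in> {0, 1}" "z a i \<in> {0, 1}" for a i
    by (auto simp: y_def z_def)
  show ?thesis
    unfolding lb_feasible_def
  proof (intro conjI ballI)
    fix a i assume "a \<in> jobs I" "i \<in> {1..n} - active_set I n t a"
    then show "0 \<le> (t i - t (i - 1)) * arc_cap I a" using cap jobs_sub by blast
  qed (use bal bin cap cap' job in blast)+
qed

lemma lower_bound_value_well_defined:
  assumes "discretization I n t"
  shows "conformal I n t \<Longrightarrow> {flow_value I n x |x w y z. lb_feasible I n t x w y z} \<noteq> {}"
    and "bdd_above {flow_value I n x |x w y z. lb_feasible I n t x w y z}"
proof -
  show "{flow_value I n x |x w y z. lb_feasible I n t x w y z} \<noteq> {}" if "conformal I n t"
    using lb_feasible_release[OF assms that] by blast
  show "bdd_above {flow_value I n x |x w y z. lb_feasible I n t x w y z}"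
    by (rule bdd_aboveI) (use lb_feasible_value_le[OF assms] in blast)
qed

end

end

(* An integer solution picks, for every job, one interval of the discretization to start in; starting
   at the left end of that interval gives a schedule. By conformality all its breakpoints are grid
   points, so the grid refines the breakpoints and summing the flow over the grid intervals between
   consecutive breakpoints gives a feasible flow of the same value. *)
theory Submission
  imports Defs
begin

section \<open>Aggregating a flow over blocks of intervals\<close>

text \<open>Here \<open>e\<close> sends the number of a coarse grid point to the number of the same
  point in the fine grid. As interval \<open>i\<close> is the one ending at point \<open>i\<close>,
  the fine intervals inside coarse interval \<open>j\<close> start at
  \<open>Suc (e (j - 1))\<close>.\<close>

definition block :: "(nat \<Rightarrow> nat) \<Rightarrow> nat \<Rightarrow> nat set" where
  "block e j = {Suc (e (j - 1))..e j}"

text \<open>\<open>x a i\<close> is the total flow during an interval, not a rate, so merging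
  intervals is a plain sum without length weights.\<close>

definition aggregate :: "(nat \<Rightarrow> nat) \<Rightarrow> ('a \<Rightarrow> nat \<Rightarrow> real) \<Rightarrow> 'a \<Rightarrow> nat \<Rightarrow> real" where
  "aggregate e x a j = (\<Sum>i\<in>block e j. x a i)"

text \<open>Monotonicity makes consecutive blocks disjoint and adjacent; a repeated value of
  \<open>e\<close> gives an empty block.\<close>

lemma sum_blocks:
  fixes f :: "nat \<Rightarrow> 'b::comm_monoid_add"
  assumes "mono_on {0..m} e"
  shows "(\<Sum>j=1..m. \<Sum>i\<in>block e j. f i) = (\<Sum>i\<in>{Suc (e 0)..e m}. f i)"
  using assms
proof (induction m)
  case (Suc m)
  have le: "e 0 \<le> e m" "e m \<le> e (Suc m)"
    using Suc.prems by (auto intro: mono_onD)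
  have "{Suc (e 0)..e (Suc m)} = {Suc (e 0)..e m} \<union> block e (Suc m)"
    using le by (auto simp: block_def)
  moreover have "{Suc (e 0)..e m} \<inter> block e (Suc m) = {}"
    by (auto simp: block_def)
  moreover have "mono_on {0..m} e"
    using Suc.prems by (rule mono_on_subset) auto
  ultimately show ?case
    using Suc.IH by (simp add: sum.union_disjoint block_def)
qed simp

lemma block_subset:
  assumes "mono_on {0..m} e" "j \<in> {1..m}"
  shows "block e j \<subseteq> {1..e m}"
proof -
  have "e j \<le> e m" using assms by (intro mono_onD[of "{0..m}" e]) auto
  then show ?thesis by (auto simp: block_def)
qed

text \<open>Serves two purposes: with the grid \<open>t\<close> as \<open>g\<close> it adds up
  interval lengths, with the stored amounts \<open>w v\<close> it adds up changes of
  storage.\<close>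

lemma sum_block_telescope:
  fixes g :: "nat \<Rightarrow> real"
  assumes "mono_on {0..m} e" "j \<in> {1..m}"
  shows "(\<Sum>i\<in>block e j. g i - g (i - 1)) = g (e j) - g (e (j - 1))"
proof -
  have "e (j - 1) \<le> e j" using assms by (intro mono_onD[of "{0..m}" e]) auto
  then show ?thesis unfolding block_def by (rule sum_telescope'')
qed

lemma sum_aggregate: "(\<Sum>a\<in>A. aggregate e x a j) = (\<Sum>i\<in>block e j. \<Sum>a\<in>A. x a i)"
  unfolding aggregate_def by (rule sum.swap)

lemma flow_value_aggregate:
  assumes "mono_on {0..m} e" "e 0 = 0"
  shows "flow_value I m (aggregate e x) = flow_value I (e m) x"
  using sum_blocks[OF assms(1)] assms(2)
  by (simp add: flow_value_def sum_aggregate flip: sum_subtractf)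

text \<open>Conservation is linear, so it survives summation over a block. Stored amounts are levels
  rather than flows: they are read off at the block ends, where bounds and boundary values are
  inherited.\<close>

lemma flow_balance_aggregate:
  assumes e: "mono_on {0..m} e" "e 0 = 0" and bal: "flow_balance I (e m) x w"
  shows "flow_balance I m (aggregate e x) (\<lambda>v j. w v (e j))"
proof -
  have sub: "i \<in> {1..e m}" if "j \<in> {1..m}" "i \<in> block e j" for i j
    using block_subset[OF e(1)] that by blast
  have le: "e j \<in> {0..e m}" if "j \<in> {0..m}" for j
    using e(1) that by (auto intro: mono_onD)
  have "0 \<le> aggregate e x a j" if "a \<in> arcs (net I)" "j \<in> {1..m}" for a j
    unfolding aggregate_def
    by (rule sum_nonneg) (use sub[OF that(2)] that(1) bal in \<open>unfold flow_balance_def, blast\<close>)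
  moreover have "(\<Sum>a\<in>out_arcs (net I) v. aggregate e x a j)
      = (\<Sum>a\<in>in_arcs (net I) v. aggregate e x a j)"
    if "v \<in> verts (net I) - (storage I \<union> {source I, sink I})" "j \<in> {1..m}" for v j
    unfolding sum_aggregate
    by (rule sum.cong) (use sub[OF that(2)] that(1) bal in \<open>unfold flow_balance_def, blast+\<close>)
  moreover have "(\<Sum>a\<in>out_arcs (net I) v. aggregate e x a j) + w v (e j)
      = (\<Sum>a\<in>in_arcs (net I) v. aggregate e x a j) + w v (e (j - 1))"
    if "v \<in> storage I" "j \<in> {1..m}" for v j
  proof -
    \<comment> \<open>Written as net inflow equal to change of level, the storage equations
      telescope over the block.\<close>
    have "(\<Sum>i\<in>block e j. (\<Sum>a\<in>in_arcs (net I) v. x a i) - (\<Sum>a\<in>out_arcs (net I) v. x a i))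
        = (\<Sum>i\<in>block e j. w v i - w v (i - 1))"
    proof (rule sum.cong)
      fix i assume "i \<in> block e j"
      then have "(\<Sum>a\<in>out_arcs (net I) v. x a i) + w v i
          = (\<Sum>a\<in>in_arcs (net I) v. x a i) + w v (i - 1)"
        using sub[OF that(2)] that(1) bal unfolding flow_balance_def by blast
      then show "(\<Sum>a\<in>in_arcs (net I) v. x a i) - (\<Sum>a\<in>out_arcs (net I) v. x a i)
          = w v i - w v (i - 1)" by simp
    qed simp
    also have "\<dots> = w v (e j) - w v (e (j - 1))"
      by (rule sum_block_telescope[OF e(1) that(2)])
    finally show ?thesis
      by (simp add: sum_aggregate sum_subtractf)
  qed
  ultimately show ?thesis
    using bal le e(2) unfolding flow_balance_def by auto
qed

text \<open>The bounds are proportional to interval lengths, and the lengths in a block add up to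
  the length of the coarse interval.\<close>

lemma aggregate_le:
  assumes "mono_on {0..m} e" "j \<in> {1..m}"
    and "\<And>i. i \<in> {1..e m} \<Longrightarrow> x a i \<le> (t i - t (i - 1)) * u"
  shows "aggregate e x a j \<le> (t (e j) - t (e (j - 1))) * u"
proof -
  have "aggregate e x a j \<le> (\<Sum>i\<in>block e j. (t i - t (i - 1)) * u)"
    unfolding aggregate_def by (rule sum_mono) (use block_subset[OF assms(1,2)] assms(3) in blast)
  also have "\<dots> = (t (e j) - t (e (j - 1))) * u"
    by (simp only: sum_block_telescope[OF assms(1,2)] flip: sum_distrib_right)
  finally show ?thesis .
qed

text \<open>One capacity bound for all arcs: since \<open>z\<close> is binary, the factor
  \<open>1 - z a i\<close> either leaves the full capacity or lowers it to zero.\<close>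

lemma lb_feasible_arc_le:
  assumes "discretization I n t" "lb_feasible I n t x w y z" "0 \<le> arc_cap I a"
    and "a \<in> arcs (net I)" "i \<in> {1..n}"
  shows "x a i \<le> (t i - t (i - 1)) * arc_cap I a"
proof (cases "a \<in> jobs I \<and> i \<in> active_set I n t a")
  case True
  then have z: "z a i \<in> {0, 1}"
    and le: "x a i \<le> (t i - t (i - 1)) * (1 - z a i) * arc_cap I a"
    using assms(2) unfolding lb_feasible_def by blast+
  have "t (i - 1) < t i"
    using assms(1,5) by (intro discretization_less) auto
  then have "0 \<le> (t i - t (i - 1)) * arc_cap I a" using assms(3) by simp
  then show ?thesis using z le by auto
next
  case False
  then show ?thesis using assms(2,4,5) unfolding lb_feasible_def by blast
qed

text \<open>Extracts the chosen start interval from the variables \<open>y\<close>. Some value is 1,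
  and the remaining nonnegative values sum to 0.\<close>

lemma sum_binary_eq_1:
  fixes f :: "'b \<Rightarrow> real"
  assumes "finite S" "\<And>i. i \<in> S \<Longrightarrow> f i \<in> {0, 1}" "sum f S = 1"
  obtains k where "k \<in> S" "\<forall>i\<in>S. f i = of_bool (i = k)"
proof -
  have "\<exists>k\<in>S. f k = 1"
    using assms(2,3) by (metis insertE singletonD sum.neutral zero_neq_one)
  then obtain k where k: "k \<in> S" "f k = 1" by blast
  have "sum f (S - {k}) = 0"
    using assms(1,3) k by (simp add: sum_diff1)
  moreover have "0 \<le> f i" if "i \<in> S - {k}" for i
    using assms(2)[of i] that by auto
  ultimately have "\<forall>i\<in>S - {k}. f i = 0"
    using assms(1) by (subst (asm) sum_nonneg_eq_0_iff) auto
  then show thesis using k by (intro that[of k]) auto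
qed

section \<open>Consecutive breakpoints of a schedule\<close>

context maintenance_problem
begin

lemma \<tau>_in_breakpoints: "j \<le> intervals I \<sigma> \<Longrightarrow> \<tau> I \<sigma> j \<in> breakpoints I \<sigma>"
proof -
  assume "j \<le> intervals I \<sigma>"
  moreover have "card (breakpoints I \<sigma>) > 0"
    using finite_breakpoints by (auto simp: card_gt_0_iff breakpoints_def)
  ultimately show ?thesis
    using finite_breakpoints[of \<sigma>] nth_mem[of j "sorted_list_of_set (breakpoints I \<sigma>)"]
    by (simp add: \<tau>_def intervals_def)
qed

text \<open>No breakpoint lies strictly between two consecutive values of \<open>\<tau>\<close>.
  This will place the left end of a busy interval after the job's start.\<close>

lemma breakpoint_le_pred:
  assumes "b \<in> breakpoints I \<sigma>" "j \<le> intervals I \<sigma>" "b < \<tau> I \<sigma> j"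
  shows "b \<le> \<tau> I \<sigma> (j - 1)"
proof -
  have "b \<in> set (sorted_list_of_set (breakpoints I \<sigma>))"
    using assms(1) finite_breakpoints by simp
  then obtain i where "i < card (breakpoints I \<sigma>)" "\<tau> I \<sigma> i = b"
    unfolding in_set_conv_nth \<tau>_def by auto
  then have i: "i \<le> intervals I \<sigma>" "\<tau> I \<sigma> i = b"
    by (auto simp: intervals_def)
  then have "i < j" using \<tau>_mono[of j i \<sigma>] assms(3) by force
  then show ?thesis using \<tau>_mono[of i "j - 1" \<sigma>] i assms(2) by auto
qed

section \<open>The schedule of an integer solution\<close>

lemma lb_feasible_start:
  assumes disc: "discretization I n t" and conf: "conformal I n t"
    and lb: "lb_feasible I n t x w y z" and a: "a \<in> jobs I"
  obtains s where "s \<in> t ` {0..n}" "s + ptime I a \<in> t ` {0..n}"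
    and "s \<in> {release I a .. deadline I a - ptime I a}"
    and "\<And>i. i \<in> {1..n} \<Longrightarrow> s \<le> t (i - 1) \<Longrightarrow> t i \<le> s + ptime I a \<Longrightarrow> x a i = 0"
proof -
  note less = discretization_less_iff[OF disc]
  have "finite (start_set I n t a)" by (simp add: start_set_def)
  moreover have "y a i \<in> {0, 1}" if "i \<in> start_set I n t a" for i
    using lb a that unfolding lb_feasible_def by blast
  moreover have "sum (y a) (start_set I n t a) = 1"
    using lb a unfolding lb_feasible_def by blast
  ultimately obtain k where k: "k \<in> start_set I n t a"
    and y: "\<forall>i\<in>start_set I n t a. y a i = of_bool (i = k)"
    by (rule sum_binary_eq_1)
  have kn: "1 \<le> k" "k \<le> n" and k': "release I a < t k" "t (k - 1) \<le> deadline I a - ptime I a"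
    using k by (auto simp: start_set_def)
  define s where "s = t (k - 1)"
  \<comment> \<open>\<open>start_set\<close> only bounds the release time by the right end
    \<open>t k\<close>. Being a grid point itself, the release time cannot lie strictly inside
    interval \<open>k\<close>, hence is at most \<open>s\<close>.\<close>
  have "release I a \<in> t ` {0..n}" using conf a unfolding conformal_def by blast
  then obtain j where j: "j \<le> n" "t j = release I a" by (metis atLeastAtMost_iff imageE)
  then have "j < k" using less(1)[of j k] k' kn by simp
  then have "release I a \<le> s" using less(2)[of j "k - 1"] j kn by (simp add: s_def)
  then have win: "s \<in> {release I a .. deadline I a - ptime I a}"
    using k' by (simp add: s_def)
  have grid: "s \<in> t ` {0..n}" using kn by (simp add: s_def)
  moreover have "s + ptime I a \<in> t ` {0..n}"
    using conf a win grid unfolding conformal_def by blast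
  moreover have "x a i = 0"
    if i: "i \<in> {1..n}" and si: "s \<le> t (i - 1)" "t i \<le> s + ptime I a" for i
  proof -
    have "t (i - 1) < t i" using i by (intro discretization_less[OF disc]) auto
    then have act: "i \<in> active_set I n t a"
      using i si win by (simp add: active_set_def)
    \<comment> \<open>A job started at \<open>s\<close> covers interval \<open>i\<close>, so the sum
      defining \<open>z a i\<close> contains the only nonzero start variable, \<open>y a k\<close>.
      Then \<open>z a i = 1\<close>, which closes the arc.\<close>
    have kP: "k \<in> P_set I n t a i"
      using k si by (simp add: P_set_def s_def)
    have fin: "finite (P_set I n t a i)"
      by (simp add: P_set_def start_set_def)
    have "z a i = (\<Sum>l\<in>P_set I n t a i. y a l)"
      using lb a act unfolding lb_feasible_def by blast
    also have "\<dots> = (\<Sum>l\<in>P_set I n t a i. if l = k then 1 else 0)"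
      by (rule sum.cong) (auto simp: y P_set_def)
    also have "\<dots> = 1" using kP fin by simp
    finally have "z a i = 1" .
    moreover have "x a i \<le> (t i - t (i - 1)) * (1 - z a i) * arc_cap I a"
      using lb a act unfolding lb_feasible_def by blast
    moreover have "flow_balance I n x w"
      using lb unfolding lb_feasible_def by blast
    then have "0 \<le> x a i"
      using a i jobs_sub unfolding flow_balance_def by blast
    ultimately show ?thesis by simp
  qed
  ultimately show thesis using that win by blast
qed

lemma lb_feasible_imp_schedule:
  assumes disc: "discretization I n t" and conf: "conformal I n t"
    and lb: "lb_feasible I n t x w y z"
  obtains \<sigma> x' w' where "\<sigma> \<in> schedules I" "feasible_flow I \<sigma> x' w'"
    and "flow_value I (intervals I \<sigma>) x' = flow_value I n x"
proof -
  note less = discretization_less_iff[OF disc]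
  have "\<forall>a\<in>jobs I. \<exists>s. s \<in> t ` {0..n} \<and> s + ptime I a \<in> t ` {0..n}
      \<and> s \<in> {release I a .. deadline I a - ptime I a}
      \<and> (\<forall>i\<in>{1..n}. s \<le> t (i - 1) \<longrightarrow> t i \<le> s + ptime I a \<longrightarrow> x a i = 0)"
    using lb_feasible_start[OF disc conf lb] by metis
  then obtain s where s: "\<And>a. a \<in> jobs I \<Longrightarrow> s a \<in> t ` {0..n} \<and> s a + ptime I a \<in> t ` {0..n}
      \<and> s a \<in> {release I a .. deadline I a - ptime I a}
      \<and> (\<forall>i\<in>{1..n}. s a \<le> t (i - 1) \<longrightarrow> t i \<le> s a + ptime I a \<longrightarrow> x a i = 0)"
    by (metis (no_types, lifting))
  \<comment> \<open>Members of \<open>schedules\<close> are extensional, so the chosen start times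
    must be undefined off the jobs.\<close>
  define \<sigma> where "\<sigma> = restrict s (jobs I)"
  have \<sigma>: "\<sigma> a = s a" if "a \<in> jobs I" for a
    using that by (simp add: \<sigma>_def)
  have sched: "\<sigma> \<in> schedules I"
    using s by (simp add: \<sigma>_def schedules_def)
  define m where "m = intervals I \<sigma>"
  have "0 \<in> t ` {0..n}" "horizon I \<in> t ` {0..n}"
    using disc unfolding discretization_def by (metis atLeastAtMost_iff imageI le0 order_refl)+
  then have "breakpoints I \<sigma> \<subseteq> t ` {0..n}"
    using s \<sigma> by (auto simp: breakpoints_def)
  then have "\<forall>j\<in>{0..m}. \<exists>i\<le>n. t i = \<tau> I \<sigma> j"
    using \<tau>_in_breakpoints[of _ \<sigma>] by (fastforce simp: m_def)
  \<comment> \<open>All breakpoints are grid points; \<open>e j\<close> is the grid index of the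
    \<open>j\<close>-th one. It is monotone with \<open>e 0 = 0\<close> and \<open>e m = n\<close>
    because \<open>t\<close> is strictly increasing, so the blocks exhaust the grid.\<close>
  then obtain e where e: "\<And>j. j \<le> m \<Longrightarrow> e j \<le> n \<and> t (e j) = \<tau> I \<sigma> j"
    by (metis atLeastAtMost_iff le0)
  have mono: "mono_on {0..m} e"
  proof (rule mono_onI)
    fix i j assume "i \<in> {0..m}" "j \<in> {0..m}" "i \<le> j"
    then show "e i \<le> e j"
      using e[of i] e[of j] \<tau>_mono[of i j \<sigma>] less(2)[of "e i" "e j"] by (simp add: m_def)
  qed
  have e0: "e 0 = 0"
    using e[of 0] \<tau>_ends(1)[OF sched] disc less(3)[of "e 0" 0] by (simp add: discretization_def)
  have em: "e m = n"
    using e[of m] \<tau>_ends(2)[OF sched] disc less(3)[of "e m" n] by (simp add: discretization_def m_def)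
  have bal: "flow_balance I n x w"
    using lb unfolding lb_feasible_def by blast
  have cap: "aggregate e x a j \<le> (\<tau> I \<sigma> j - \<tau> I \<sigma> (j - 1)) * arc_cap I a"
    if "a \<in> arcs (net I)" "j \<in> {1..m}" for a j
  proof -
    have "aggregate e x a j \<le> (t (e j) - t (e (j - 1))) * arc_cap I a"
      using lb_feasible_arc_le[OF disc lb arc_cap_nonneg] that em
      by (intro aggregate_le[OF mono]) auto
    then show ?thesis using e[of j] e[of "j - 1"] that(2) by auto
  qed
  have idle: "aggregate e x a j = 0" if a: "a \<in> jobs I" and j: "j \<in> busy I \<sigma> a" for a j
    unfolding aggregate_def
  proof (intro sum.neutral ballI)
    fix i assume i: "i \<in> block e j"
    have jm: "j \<in> {1..m}" and busy: "\<sigma> a < \<tau> I \<sigma> j" "\<tau> I \<sigma> j \<le> \<sigma> a + ptime I a"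
      using j by (auto simp: busy_def m_def)
    \<comment> \<open>\<open>busy\<close> constrains only the right end of interval
      \<open>j\<close>. As the start of the job is itself a breakpoint, the left end lies in the
      processing period too, and with it every fine interval of the block.\<close>
    have "\<sigma> a \<in> breakpoints I \<sigma>" using a by (auto simp: breakpoints_def)
    then have "\<sigma> a \<le> \<tau> I \<sigma> (j - 1)"
      using breakpoint_le_pred busy(1) jm by (simp add: m_def)
    then have "s a \<le> t (e (j - 1))" using e[of "j - 1"] jm \<sigma>[OF a] by auto
    moreover have "t (e j) \<le> s a + ptime I a"
      using e[of j] jm busy(2) \<sigma>[OF a] by simp
    moreover have "i \<in> {1..n}" using i block_subset[OF mono jm] em by blast
    moreover have "t (e (j - 1)) \<le> t (i - 1)" "t i \<le> t (e j)"
      using i e[of j] jm less(2)[of "e (j - 1)" "i - 1"] less(2)[of i "e j"]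
      by (auto simp: block_def)
    ultimately show "x a i = 0"
      using s[OF a] by force
  qed
  have "feasible_flow I \<sigma> (aggregate e x) (\<lambda>v j. w v (e j))"
    using flow_balance_aggregate[OF mono e0, of I x w] bal em cap idle jobs_sub
    unfolding feasible_flow_def m_def[symmetric] by blast
  moreover have "flow_value I (intervals I \<sigma>) (aggregate e x) = flow_value I n x"
    using flow_value_aggregate[OF mono e0, of I x] em by (simp add: m_def)
  ultimately show thesis using that sched by blast
qed

section \<open>From single solutions to suprema\<close>

lemma feasible_flow_value_le_optimal_value:
  assumes "\<sigma> \<in> schedules I" "feasible_flow I \<sigma> x w"
  shows "flow_value I (intervals I \<sigma>) x \<le> optimal_value I"
proof -
  have "flow_value I (intervals I \<sigma>) x \<le> val I \<sigma>"
    unfolding val_def using val_well_defined(2)[OF assms(1)] assms(2) by (intro cSup_upper) auto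
  also have "\<dots> \<le> optimal_value I"
    unfolding optimal_value_def using optimal_value_well_defined(2) assms(1) by (rule cSUP_upper2) simp
  finally show ?thesis .
qed

lemma lower_bound_value_le_optimal_value:
  assumes "discretization I n t" "conformal I n t"
  shows "lower_bound_value I n t \<le> optimal_value I"
  unfolding lower_bound_value_def
proof (rule cSup_least)
  \<comment> \<open>The supremum of the empty set of reals is unspecified. Conformality excludes
    this case: starting all jobs at their release times with zero flow is feasible.\<close>
  show "{flow_value I n x |x w y z. lb_feasible I n t x w y z} \<noteq> {}"
    using lower_bound_value_well_defined(1) assms by blast
  fix b assume "b \<in> {flow_value I n x |x w y z. lb_feasible I n t x w y z}"
  then show "b \<le> optimal_value I"
    using lb_feasible_imp_schedule[OF assms] feasible_flow_value_le_optimal_value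
    by (smt (verit) mem_Collect_eq)
qed

end

theorem proposition4:
  fixes I :: "('v, 'a) maintenance_instance" and n :: nat and t :: "nat \<Rightarrow> real"
  assumes "maintenance_problem I"
    and "discretization I n t"
    and "conformal I n t"
  shows "optimal_value I \<ge> lower_bound_value I n t"
  using assms by (rule maintenance_problem.lower_bound_value_le_optimal_value)

end
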